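(* Let $r_1,r_2,r_3,r_4,a_1,a_2,a_3,a_4,m\in\mathbb{Z}$ be such that $a_1,a_2,a_3,a_4,m$ are positive and the following four equalities hold: \begin{align*} a_1-r_1-m\left\lceil\frac{a_1-2r_1}{2m}\right\rceil &= a_3-r_3-m\left\lceil\frac{a_3-2r_3}{2m}\right\rceil,\\ a_1+r_1-m\left\lceil\frac{a_1+2r_1}{2m}\right\rceil &= a_4-r_4-m\left\lceil\frac{a_4-2r_4}{2m}\right\rceil,\\ a_2-r_2-m\left\lceil\frac{a_2-2r_2}{2m}\right\rceil &= a_4+r_4-m\left\lceil\frac{a_4+2r_4}{2m}\right\rceil,\\ a_2+r_2-m\left\lceil\frac{a_2+2r_2}{2m}\right\rceil &= a_3+r_3-m\left\lceil\frac{a_3+2r_3}{2m}\right\rceil. \end{align*} Then for every integer $n\ge 0$, $$N^+(r_1,m,2mn+a_1)+N^+(r_2,m,2mn+a_2)=N^+(r_3,m,2mn+a_3)+N^+(r_4,m,2mn+a_4).$$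
   Context: A partition of a positive integer $n$ is a nonincreasing sequence $\lambda=(\lambda_1,\ldots,\lambda_k)$ of positive integers with sum $n$. $P(n)$ denotes the set of partitions of $n$, with $P(n)=\emptyset$ if $n$ is not a positive integer. The (Dyson) rank of $\lambda=(\lambda_1,\ldots,\lambda_k)$ with $\lambda_1\ge\cdots\ge\lambda_k\ge 1$ is $\operatorname{rank}(\lambda):=\lambda_1-k$, i.e. the largest part minus the number of parts. For integers $r,n$ and a positive integer $m$, $$N^+(r,m,n):=\#\left\{\lambda\in P(n):\operatorname{rank}(\lambda)\equiv r\pmod m,\ |\operatorname{rank}(\lambda)|\ge\frac n2\right\}.$$ $\lceil x\rceil$ denotes the least integer that is at least $x$ (ceiling of a rational number). *)

theory Defs
  imports Complex_Main "HOL-Number_Theory.Cong"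
begin

definition partitions_of :: "int \<Rightarrow> nat list set" where
  "partitions_of n =
     {l. n > 0 \<and> sorted_wrt (\<ge>) l \<and> (\<forall>x\<in>set l. x > 0) \<and> int (sum_list l) = n}"

text \<open>Only used for nonempty lists: the members of \<open>partitions_of n\<close> are nonempty
  because \<open>n > 0\<close> is required there, so \<open>hd\<close> is the largest part.\<close>

definition partition_rank :: "nat list \<Rightarrow> int" where
  "partition_rank l = int (hd l) - int (length l)"

definition Nplus :: "int \<Rightarrow> int \<Rightarrow> int \<Rightarrow> nat" where
  "Nplus r m n = card {l \<in> partitions_of n.
     [partition_rank l = r] (mod m) \<and>
     of_int \<bar>partition_rank l\<bar> \<ge> (of_int n / 2 :: rat)}"

text \<open>The cardinality in \<open>Nplus\<close> is never that of an infinite set.\<close>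

lemma finite_partitions_of: "finite (partitions_of n)"
proof (rule finite_subset)
  show "partitions_of n \<subseteq> {l. set l \<subseteq> {..nat n} \<and> length l \<le> nat n}"
  proof
    fix l assume l: "l \<in> partitions_of n"
    have "length l \<le> sum_list l" if "\<forall>x\<in>set l. x > 0" for l :: "nat list"
      using that by (induction l) auto
    with l show "l \<in> {l. set l \<subseteq> {..nat n} \<and> length l \<le> nat n}"
      by (auto simp: partitions_of_def dest: member_le_sum_list)
  qed
  show "finite {l. set l \<subseteq> {..nat n} \<and> length l \<le> nat n}"
    by (rule finite_lists_length_le) simp
qed

end

theory Submission
  imports Defs
begin

text \<open>
  A rank of at least \<open>n / 2\<close> leaves so little room below the largest part that this part no longer
  constrains the others. Deleting the largest part from a partition of \<open>n\<close> of rank \<open>s \<ge> n / 2\<close> and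
  adding 1 to each remaining part therefore gives every partition of \<open>n - 1 - s\<close> into parts of size
  at least 2 exactly once (\<open>bij_betw_top_rank\<close>). So the number of partitions with a large rank \<open>s\<close>
  depends on the difference \<open>n - s\<close> alone.

  The ranks \<open>s \<equiv> r\<close> modulo \<open>m\<close> with \<open>s \<ge> n / 2\<close> form the progression with step \<open>m\<close> that starts at
  \<open>r + m * \<lceil>(n - 2 * r) / (2 * m)\<rceil>\<close>. Summing over it gives a number that depends only on \<open>m\<close> and on
  the difference of \<open>n\<close> and this least rank, which is called the threshold of \<open>n\<close> and \<open>r\<close> below. Conjugation
  negates the rank, so the ranks \<open>s \<le> - n / 2\<close> contribute in the same way with \<open>- r\<close> in
  place of \<open>r\<close>. Hence \<open>Nplus r m n\<close> is the sum of the values of one and the same function at the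
  thresholds of \<open>(n, r)\<close> and \<open>(n, - r)\<close> (\<open>Nplus_eq\<close>).

  Replacing \<open>a\<close> by \<open>2 * m * n + a\<close> shifts every threshold by \<open>m * n\<close>. The four hypotheses say that
  the four thresholds on the left agree with those on the right in some order, and they
  continue to agree after the common shift.
\<close>

section \<open>Conjugate partitions\<close>

text \<open>The \<open>j\<close>-th part of the conjugate is the length of the \<open>j\<close>-th column of the Young diagram,
  counting columns from 0.\<close>

definition conjugate :: "nat list \<Rightarrow> nat list" where
  "conjugate l = (case l of [] \<Rightarrow> []
     | x # _ \<Rightarrow> map (\<lambda>j. length (filter (\<lambda>y. j < y) l)) [0..<x])"

lemma length_conjugate: "l \<noteq> [] \<Longrightarrow> length (conjugate l) = hd l"
  by (cases l) (auto simp: conjugate_def)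

lemma nth_conjugate:
  "l \<noteq> [] \<Longrightarrow> j < hd l \<Longrightarrow> conjugate l ! j = length (filter (\<lambda>y. j < y) l)"
  by (cases l) (auto simp: conjugate_def)

text \<open>The cell in row \<open>i\<close> and column \<open>j\<close> belongs to the Young diagram if and only if column \<open>j\<close> has
  more than \<open>i\<close> cells. Both monotonicity and involutivity of conjugation come from this symmetry.\<close>

lemma less_column_iff:
  fixes l :: "nat list"
  assumes "sorted_wrt (\<ge>) l"
  shows "i < length (filter (\<lambda>y. j < y) l) \<longleftrightarrow> i < length l \<and> j < l ! i"
  using assms
proof (induction l arbitrary: i)
  case Nil
  then show ?case by simp
next
  case (Cons x l)
  show ?case
  proof (cases "j < x")
    case True
    with Cons show ?thesis by (cases i) auto
  next
    case False
    with Cons.prems have small: "\<forall>y\<in>set (x # l). \<not> j < y" by auto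
    then have "filter (\<lambda>y. j < y) (x # l) = []" by (simp only: filter_empty_conv)
    moreover have "\<not> j < (x # l) ! i" if "i < length (x # l)"
      using small nth_mem[OF that] by blast
    ultimately show ?thesis by auto
  qed
qed

lemma sorted_conjugate:
  assumes "sorted_wrt (\<ge>) l"
  shows "sorted_wrt (\<ge>) (conjugate l)"
proof (cases "l = []")
  case True
  then show ?thesis by (simp add: conjugate_def)
next
  case False
  have "length (filter (\<lambda>y. j < y) l) \<le> length (filter (\<lambda>y. i < y) l)" if "i < j" for i j
    using less_column_iff[OF assms, of "length (filter (\<lambda>y. i < y) l)"] that
    by (meson less_irrefl less_trans not_le)
  with False show ?thesis
    by (auto simp: sorted_wrt_iff_nth_less length_conjugate nth_conjugate)
qed

lemma conjugate_pos:
  assumes "x \<in> set (conjugate l)"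
  shows "0 < x"
proof (cases l)
  case Nil
  with assms show ?thesis by (simp add: conjugate_def)
next
  case (Cons y ys)
  with assms show ?thesis by (auto simp: conjugate_def)
qed

lemma hd_conjugate:
  assumes "l \<noteq> []" and "\<forall>x\<in>set l. 0 < x"
  shows "conjugate l \<noteq> []" and "hd (conjugate l) = length l"
proof -
  have "0 < hd l" using assms by simp
  then show ne: "conjugate l \<noteq> []" using length_conjugate[OF assms(1)] by auto
  have "hd (conjugate l) = length (filter (\<lambda>y. 0 < y) l)"
    using \<open>0 < hd l\<close> ne nth_conjugate[OF assms(1), of 0] by (simp add: hd_conv_nth)
  also have "filter (\<lambda>y. 0 < y) l = l" using assms(2) by simp
  finally show "hd (conjugate l) = length l" .
qed

text \<open>Both sides count the cells of the Young diagram, and columns beyond the largest part are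
  empty.\<close>

lemma sum_columns:
  fixes l :: "nat list"
  assumes "\<forall>x\<in>set l. x \<le> M"
  shows "(\<Sum>j<M. length (filter (\<lambda>y. j < y) l)) = sum_list l"
  using assms
proof (induction l)
  case Nil
  then show ?case by simp
next
  case (Cons x l)
  have "(\<Sum>j<M. length (filter (\<lambda>y. j < y) (x # l)))
      = (\<Sum>j<M. (if j < x then 1 else 0) + length (filter (\<lambda>y. j < y) l))"
    by (intro sum.cong) auto
  also have "\<dots> = card ({..<M} \<inter> {j. j < x}) + sum_list l"
    using Cons by (simp add: sum.distrib sum.If_cases)
  also have "{..<M} \<inter> {j. j < x} = {..<x}" using Cons.prems by auto
  finally show ?case by simp
qed

lemma sum_list_conjugate:
  assumes "sorted_wrt (\<ge>) l"
  shows "sum_list (conjugate l) = sum_list l"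
proof (cases l)
  case Nil
  then show ?thesis by (simp add: conjugate_def)
next
  case (Cons x xs)
  with assms have "\<forall>y\<in>set l. y \<le> x" by auto
  have "sum_list (conjugate l) = (\<Sum>j<x. length (filter (\<lambda>y. j < y) l))"
    by (simp add: conjugate_def Cons interv_sum_list_conv_sum_set_nat atLeast0LessThan
        del: filter.simps)
  with sum_columns[OF \<open>\<forall>y\<in>set l. y \<le> x\<close>] show ?thesis by simp
qed

lemma conjugate_conjugate:
  assumes "sorted_wrt (\<ge>) l" and "\<forall>x\<in>set l. 0 < x"
  shows "conjugate (conjugate l) = l"
proof (cases "l = []")
  case True
  then show ?thesis by (simp add: conjugate_def)
next
  case False
  note hd = hd_conjugate[OF False assms(2)]
  show ?thesis
  proof (rule nth_equalityI)
    show len: "length (conjugate (conjugate l)) = length l"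
      by (simp add: length_conjugate hd)
    fix i assume "i < length (conjugate (conjugate l))"
    then have i: "i < length l" by (simp add: len)
    then have "l ! i \<le> hd l"
      using assms(1) False by (cases l; cases i) auto
    have "conjugate (conjugate l) ! i = length (filter (\<lambda>y. i < y) (conjugate l))"
      using i by (simp add: nth_conjugate hd)
    also have "\<dots> = card {j. j < hd l \<and> i < conjugate l ! j}"
      by (simp add: length_filter_conv_card length_conjugate False)
    also have "{j. j < hd l \<and> i < conjugate l ! j} = {j. j < l ! i}"
      using \<open>l ! i \<le> hd l\<close> i False by (auto simp: nth_conjugate less_column_iff[OF assms(1)])
    finally show "conjugate (conjugate l) ! i = l ! i" by simp
  qed
qed

lemma partitions_of_nonempty: "l \<in> partitions_of n \<Longrightarrow> l \<noteq> []"
  by (auto simp: partitions_of_def)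

lemma conjugate_partition:
  assumes "l \<in> partitions_of n"
  shows "conjugate l \<in> partitions_of n"
    and "partition_rank (conjugate l) = - partition_rank l"
    and "conjugate (conjugate l) = l"
proof -
  note ne = partitions_of_nonempty[OF assms]
  have l: "sorted_wrt (\<ge>) l" "\<forall>x\<in>set l. 0 < x"
    using assms by (simp_all add: partitions_of_def)
  show "conjugate l \<in> partitions_of n"
    using assms l sorted_conjugate[OF l(1)] sum_list_conjugate[OF l(1)] conjugate_pos[of _ l]
    by (auto simp: partitions_of_def)
  show "partition_rank (conjugate l) = - partition_rank l"
    using hd_conjugate[OF ne l(2)] ne by (simp add: partition_rank_def length_conjugate)
  show "conjugate (conjugate l) = l" by (rule conjugate_conjugate[OF l])
qed

section \<open>Partitions with large rank\<close>

definition top_rank :: "int \<Rightarrow> int \<Rightarrow> int \<Rightarrow> nat list set" where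
  "top_rank r m n =
     {l \<in> partitions_of n. [partition_rank l = r] (mod m) \<and> n \<le> 2 * partition_rank l}"

definition bottom_rank :: "int \<Rightarrow> int \<Rightarrow> int \<Rightarrow> nat list set" where
  "bottom_rank r m n =
     {l \<in> partitions_of n. [partition_rank l = r] (mod m) \<and> n \<le> - 2 * partition_rank l}"

text \<open>Partitions into parts of size at least 2 of any of the numbers \<open>c - 1, c - 1 - m, \<dots>\<close>. When
  \<open>c\<close> is \<open>n\<close> minus the least rank of a progression with step \<open>m\<close>, these numbers are the values
  \<open>n - 1 - s\<close> as \<open>s\<close> runs through the progression.\<close>

definition no_ones :: "int \<Rightarrow> int \<Rightarrow> nat list set" where
  "no_ones m c = {l. sorted_wrt (\<ge>) l \<and> (\<forall>x\<in>set l. 2 \<le> x) \<and>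
     [int (sum_list l) = c - 1] (mod m) \<and> int (sum_list l) < c}"

definition threshold :: "int \<Rightarrow> int \<Rightarrow> int \<Rightarrow> int" where
  "threshold m a r = a - r - m * \<lceil>(of_int (a - 2 * r) :: rat) / of_int (2 * m)\<rceil>"

lemma threshold_shift:
  assumes "0 < m"
  shows "threshold m (2 * m * n + a) r = m * n + threshold m a r"
proof -
  have "(of_int (2 * m * n + a - 2 * r) :: rat) / of_int (2 * m)
      = of_int (a - 2 * r) / of_int (2 * m) + of_int n"
    using assms by (simp add: field_simps)
  then show ?thesis
    unfolding threshold_def by (simp only: ceiling_add_of_int) (simp add: algebra_simps)
qed

text \<open>A rank \<open>s \<equiv> r\<close> modulo \<open>m\<close> is at least \<open>n / 2\<close> if and only if it is at least the term of
  the progression that the ceiling selects.\<close>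

lemma less_threshold_iff:
  assumes "0 < m" and "[s = r] (mod m)"
  shows "n - 1 - s < threshold m n r \<longleftrightarrow> n \<le> 2 * s"
proof -
  from assms(2) obtain t where s: "s = r + m * t"
    by (metis cong_iff_lin cong_sym)
  have "n - 1 - s < threshold m n r \<longleftrightarrow>
      m * \<lceil>(of_int (n - 2 * r) :: rat) / of_int (2 * m)\<rceil> \<le> m * t"
    by (auto simp: s threshold_def)
  also have "\<dots> \<longleftrightarrow> \<lceil>(of_int (n - 2 * r) :: rat) / of_int (2 * m)\<rceil> \<le> t"
    using assms(1) by simp
  also have "\<dots> \<longleftrightarrow> (of_int (n - 2 * r) :: rat) \<le> of_int (t * (2 * m))"
    using assms(1) by (simp add: ceiling_le_iff pos_divide_le_eq)
  also have "\<dots> \<longleftrightarrow> n - 2 * r \<le> t * (2 * m)"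
    by (simp only: of_int_le_iff)
  also have "\<dots> \<longleftrightarrow> n \<le> 2 * s" by (auto simp: s algebra_simps)
  finally show ?thesis .
qed

lemma cong_threshold: "[threshold m n r = n - r] (mod m)"
  by (simp add: threshold_def cong_iff_dvd_diff)

lemma sum_list_map_Suc: "sum_list (map Suc l) = sum_list l + length l"
  by (induction l) auto

lemma sum_list_map_pred:
  "\<forall>x\<in>set l. 2 \<le> x \<Longrightarrow> sum_list (map (\<lambda>x. x - 1) l) + length l = sum_list (l :: nat list)"
  by (induction l) auto

lemma partition_rank_tl:
  assumes "l \<in> partitions_of n"
  shows "int (sum_list (map Suc (tl l))) = n - 1 - partition_rank l"
proof -
  obtain x xs where "l = x # xs"
    using partitions_of_nonempty[OF assms] by (cases l) auto
  with assms show ?thesis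
    by (auto simp: partitions_of_def partition_rank_def sum_list_map_Suc)
qed

text \<open>If the rank is \<open>s\<close> and the remaining parts, each increased by 1, are \<open>\<mu>\<close>, then the largest
  part is \<open>s\<close> plus the number of parts, that is, \<open>n - sum_list \<mu> + length \<mu>\<close>. The inequality
  \<open>n \<le> 2 * s\<close> is what makes this value exceed every entry of \<open>\<mu>\<close>, so that restoring it always
  gives a nonincreasing list.\<close>

lemma bij_betw_top_rank:
  assumes "0 < m" and "0 < n"
  shows "bij_betw (\<lambda>l. map Suc (tl l)) (top_rank r m n) (no_ones m (threshold m n r))"
proof -
  define g where
    "g \<mu> = nat (n - int (sum_list \<mu>) + int (length \<mu>)) # map (\<lambda>x. x - 1) \<mu>" for \<mu>
  have cong_iff: "[n - 1 - s = threshold m n r - 1] (mod m) \<longleftrightarrow> [s = r] (mod m)" for s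
  proof -
    have "[threshold m n r - 1 = n - r - 1] (mod m)"
      by (intro cong_diff cong_threshold cong_refl)
    then have "[n - 1 - s = threshold m n r - 1] (mod m) \<longleftrightarrow> [n - 1 - s = n - r - 1] (mod m)"
      by (meson cong_sym cong_trans)
    also have "\<dots> \<longleftrightarrow> m dvd - (s - r)" by (simp add: cong_iff_dvd_diff)
    also have "\<dots> \<longleftrightarrow> [s = r] (mod m)" by (simp only: dvd_minus_iff cong_iff_dvd_diff)
    finally show ?thesis .
  qed
  have to: "map Suc (tl l) \<in> no_ones m (threshold m n r)" and from_to: "g (map Suc (tl l)) = l"
    if l: "l \<in> top_rank r m n" for l
  proof -
    from l have P: "l \<in> partitions_of n" and c: "[partition_rank l = r] (mod m)"
      and big: "n \<le> 2 * partition_rank l" by (simp_all add: top_rank_def)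
    obtain x xs where x: "l = x # xs"
      using partitions_of_nonempty[OF P] by (cases l) auto
    note sum = partition_rank_tl[OF P]
    have "sorted_wrt (\<ge>) (map Suc (tl l))" and "\<forall>y\<in>set (map Suc (tl l)). 2 \<le> y"
      using P by (auto simp: x partitions_of_def sorted_wrt_map numeral_2_eq_2 intro: Suc_leI)
    then show "map Suc (tl l) \<in> no_ones m (threshold m n r)"
      using c big less_threshold_iff[OF assms(1) c] cong_iff[of "partition_rank l"]
      by (simp only: no_ones_def sum mem_Collect_eq)
    show "g (map Suc (tl l)) = l"
      unfolding g_def sum by (simp add: x partition_rank_def comp_def)
  qed
  have from': "g \<mu> \<in> top_rank r m n" and to_from: "map Suc (tl (g \<mu>)) = \<mu>"
    if \<mu>: "\<mu> \<in> no_ones m (threshold m n r)" for \<mu>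
  proof -
    define s where "s = n - 1 - int (sum_list \<mu>)"
    from \<mu> have sorted: "sorted_wrt (\<ge>) \<mu>" and ge2: "\<forall>x\<in>set \<mu>. 2 \<le> x"
      and c: "[n - 1 - s = threshold m n r - 1] (mod m)"
      and lt: "n - 1 - s < threshold m n r" by (simp_all add: no_ones_def s_def)
    from c have sr: "[s = r] (mod m)" by (simp only: cong_iff)
    with lt have big: "n \<le> 2 * s" using less_threshold_iff[OF assms(1)] by simp
    have le: "int x \<le> s" if "x \<in> set \<mu>" for x
      using member_le_sum_list[OF that] big by (simp add: s_def)
    have eq: "g \<mu> = nat (s + 1 + int (length \<mu>)) # map (\<lambda>x. x - 1) \<mu>"
      by (simp add: g_def s_def)
    have spos: "0 < s" using big assms(2) by simp
    have "sorted_wrt (\<ge>) (map (\<lambda>x. x - 1) \<mu>)"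
      unfolding sorted_wrt_map by (rule sorted_wrt_mono_rel[OF _ sorted]) simp
    moreover have "\<forall>x\<in>set \<mu>. x - 1 \<le> nat (s + 1 + int (length \<mu>))"
      using le by fastforce
    ultimately have "sorted_wrt (\<ge>) (g \<mu>)" by (simp add: eq)
    moreover have "\<forall>x\<in>set (g \<mu>). 0 < x" using ge2 spos by (fastforce simp: eq)
    moreover have "int (sum_list (g \<mu>)) = n"
    proof -
      have "int (sum_list (map (\<lambda>x. x - 1) \<mu>)) + int (length \<mu>) = int (sum_list \<mu>)"
        using sum_list_map_pred[OF ge2] by (simp only: of_nat_add[symmetric])
      then show ?thesis using spos unfolding eq by (simp add: s_def)
    qed
    moreover have "partition_rank (g \<mu>) = s" using spos by (simp add: eq partition_rank_def)
    ultimately show "g \<mu> \<in> top_rank r m n"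
      using sr big assms(2) by (simp add: top_rank_def partitions_of_def)
    show "map Suc (tl (g \<mu>)) = \<mu>"
      unfolding g_def using ge2 by (auto intro!: map_idI)
  qed
  show ?thesis
    by (rule bij_betw_byWitness[where f' = g]) (use to from_to from' to_from in auto)
qed

lemma bij_betw_conjugate_rank: "bij_betw conjugate (bottom_rank r m n) (top_rank (- r) m n)"
  by (rule bij_betw_byWitness[where f' = conjugate])
    (auto simp: top_rank_def bottom_rank_def conjugate_partition
      dest: cong_minus_minus_iff[THEN iffD2])

lemma Nplus_eq:
  assumes "0 < m" and "0 < n"
  shows "Nplus r m n =
    card (no_ones m (threshold m n r)) + card (no_ones m (threshold m n (- r)))"
proof -
  have half: "(of_int n / 2 :: rat) \<le> of_int \<bar>s\<bar> \<longleftrightarrow> n \<le> 2 * s \<or> n \<le> - 2 * s" for s :: int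
  proof -
    have "(of_int n / 2 :: rat) \<le> of_int \<bar>s\<bar> \<longleftrightarrow> (of_int n :: rat) \<le> of_int (2 * \<bar>s\<bar>)"
      by (simp add: field_simps)
    also have "\<dots> \<longleftrightarrow> n \<le> 2 * \<bar>s\<bar>" by (simp only: of_int_le_iff)
    finally show ?thesis by auto
  qed
  have "Nplus r m n = card (top_rank r m n \<union> bottom_rank r m n)"
    unfolding Nplus_def half top_rank_def bottom_rank_def by (rule arg_cong[where f = card]) blast
  also have "\<dots> = card (top_rank r m n) + card (bottom_rank r m n)"
  proof (rule card_Un_disjoint)
    show "finite (top_rank r m n)" "finite (bottom_rank r m n)"
      by (auto simp: top_rank_def bottom_rank_def finite_partitions_of)
    show "top_rank r m n \<inter> bottom_rank r m n = {}"
      using assms(2) by (auto simp: top_rank_def bottom_rank_def)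
  qed
  also have "card (bottom_rank r m n) = card (top_rank (- r) m n)"
    by (rule bij_betw_same_card[OF bij_betw_conjugate_rank])
  finally show ?thesis
    by (simp add: bij_betw_same_card[OF bij_betw_top_rank[OF assms]])
qed

section \<open>Equal thresholds\<close>

theorem theorem1:
  fixes r1 r2 r3 r4 a1 a2 a3 a4 m :: int
  assumes "a1 > 0" and "a2 > 0" and "a3 > 0" and "a4 > 0" and "m > 0"
    and "a1 - r1 - m * \<lceil>(of_int (a1 - 2 * r1) :: rat) / of_int (2 * m)\<rceil>
       = a3 - r3 - m * \<lceil>(of_int (a3 - 2 * r3) :: rat) / of_int (2 * m)\<rceil>"
    and "a1 + r1 - m * \<lceil>(of_int (a1 + 2 * r1) :: rat) / of_int (2 * m)\<rceil>
       = a4 - r4 - m * \<lceil>(of_int (a4 - 2 * r4) :: rat) / of_int (2 * m)\<rceil>"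
    and "a2 - r2 - m * \<lceil>(of_int (a2 - 2 * r2) :: rat) / of_int (2 * m)\<rceil>
       = a4 + r4 - m * \<lceil>(of_int (a4 + 2 * r4) :: rat) / of_int (2 * m)\<rceil>"
    and "a2 + r2 - m * \<lceil>(of_int (a2 + 2 * r2) :: rat) / of_int (2 * m)\<rceil>
       = a3 + r3 - m * \<lceil>(of_int (a3 + 2 * r3) :: rat) / of_int (2 * m)\<rceil>"
  shows "\<forall>n::int. n \<ge> 0 \<longrightarrow>
    Nplus r1 m (2 * m * n + a1) + Nplus r2 m (2 * m * n + a2)
    = Nplus r3 m (2 * m * n + a3) + Nplus r4 m (2 * m * n + a4)"
proof (intro allI impI)
  fix n :: int
  assume "0 \<le> n"
  define F where "F c = card (no_ones m (m * n + c))" for c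
  have N: "Nplus r m (2 * m * n + a) = F (threshold m a r) + F (threshold m a (- r))"
    if "0 < a" for r a
  proof -
    have "0 < 2 * m * n + a" using \<open>0 \<le> n\<close> \<open>m > 0\<close> that by (simp add: add_nonneg_pos)
    with \<open>m > 0\<close> show ?thesis by (simp add: Nplus_eq threshold_shift F_def)
  qed
  have "threshold m a1 r1 = threshold m a3 r3"
    and "threshold m a1 (- r1) = threshold m a4 r4"
    and "threshold m a2 r2 = threshold m a4 (- r4)"
    and "threshold m a2 (- r2) = threshold m a3 (- r3)"
    using assms(6-9) by (simp_all add: threshold_def)
  with \<open>a1 > 0\<close> \<open>a2 > 0\<close> \<open>a3 > 0\<close> \<open>a4 > 0\<close>
  show "Nplus r1 m (2 * m * n + a1) + Nplus r2 m (2 * m * n + a2)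
    = Nplus r3 m (2 * m * n + a3) + Nplus r4 m (2 * m * n + a4)"
    by (simp add: N)
qed

end
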